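(* Let $f\in\mathcal{C}(\Omega)$, $\lambda>0$, let the quadrature rule have exactness degree $2n$, and let $f^\epsilon=f+\epsilon$ be a noisy version of $f$, with noise values $\epsilon_j$ at the nodes, i.e. $f^{\epsilon}(\mathbf{x}_j)=f(\mathbf{x}_j)+\epsilon_j$, $j=1,\dots,N$. Let all penalty parameters of Lasso hyperinterpolation be $\mu_\ell=1$. Let $\bm{\epsilon}=[\epsilon_1,\dots,\epsilon_N]^{\mathrm{T}}\in\mathbb{R}^N$, let $\bm{\alpha}=[\alpha_1,\dots,\alpha_{d_n}]^{\mathrm{T}}$ with $\alpha_\ell=\langle f^{\epsilon},\Phi_\ell\rangle_N$, and let $\bm{\xi}=[\xi_1,\dots,\xi_{d_n}]^{\mathrm{T}}$ with $\xi_\ell=\langle\epsilon,\Phi_\ell\rangle_N$, for $\ell=1,\dots,d_n$. For $\mathbf{z}=[z_1,\dots,z_{d_n}]^{\mathrm{T}}\in\mathbb{R}^{d_n}$ define $$J(\mathbf{z})=\mathbf{z}^{\mathrm{T}}\mathbf{z}-2\mathbf{z}^{\mathrm{T}}\bm{\alpha},\qquad H(\mathbf{z})=2\mathbf{z}^{\mathrm{T}}\bm{\xi},\qquad E(\mathbf{z})=\|\mathbf{W}^{1/2}(\mathbf{A}\mathbf{z}-\mathbf{f})\|_2^2.$$ Then: (a) For Lasso hyperinterpolation, with $\bm{\gamma}^\lambda=[\gamma_1^\lambda,\dots,\gamma_{d_n}^\lambda]^{\mathrm{T}}$, $\gamma_\ell^\lambda=\eta_S(\alpha_\ell,\lambda)$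 for $\ell=1,\dots,d_n$, $$E(\bm{\gamma}^\lambda)=J(\bm{\gamma}^\lambda)+H(\bm{\gamma}^\lambda)+\|\mathbf{W}^{1/2}\mathbf{f}\|_2^2,$$ and $J(\bm{\gamma}^\lambda)\le0$. (b) For hard thresholding hyperinterpolation, with $\bm{\beta}^\lambda=[\beta_1^\lambda,\dots,\beta_{d_n}^\lambda]^{\mathrm{T}}$, $\beta_\ell^\lambda=\eta_H(\alpha_\ell,\lambda)$ for $\ell=1,\dots,d_n$, $$E(\bm{\beta}^\lambda)=J(\bm{\beta}^\lambda)+H(\bm{\beta}^\lambda)+\|\mathbf{W}^{1/2}\mathbf{f}\|_2^2,$$ and $J(\bm{\beta}^\lambda)\le0$. (c) If the regularization parameter $\lambda$ (the same in both Lasso and hard thresholding hyperinterpolations) satisfies $$\sum_{\ell=1,\ |\alpha_\ell|>\lambda}^{d_n}\left[\lambda-2\,\mathrm{sgn}(\alpha_\ell)\,\xi_\ell\right]\ge0,$$ then $E(\bm{\beta}^\lambda)\le E(\bm{\gamma}^\lambda)$.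
   Context: $\Omega\subset\mathbb{R}^s$ is a compact smooth Riemannian manifold with smooth or empty boundary, equipped with a measure $\mathrm{d}\omega$ with $\int_\Omega \mathrm{d}\omega=V<\infty$. $\mathcal{C}(\Omega)$ is the space of continuous real functions on $\Omega$, and $\langle f,g\rangle=\int_\Omega fg\,\mathrm{d}\omega$. $\mathbb{P}_n(\Omega)$ is the space of polynomials of total degree at most $n$ restricted to $\Omega$, $d_n=\dim\mathbb{P}_n(\Omega)$, and $\{\Phi_\ell\}_{\ell=1}^{d_n}$ is a fixed orthonormal basis of $\mathbb{P}_n(\Omega)$ with respect to $\langle\cdot,\cdot\rangle$. Quadrature rule: nodes $\mathbf{x}_1,\dots,\mathbf{x}_N\in\Omega$ and weights $w_1,\dots,w_N>0$ such that $\int_\Omega p\,\mathrm{d}\omega=\sum_{j=1}^N w_jp(\mathbf{x}_j)$ for all $p\in\mathbb{P}_{2n}(\Omega)$ (exactness degree $2n$). The discrete (semi) inner product is $\langle f,g\rangle_N=\sum_{j=1}^N w_jf(\mathbf{x}_j)g(\mathbf{x}_j)$ (depending only on values at the nodes; in particular $\langle\epsilon,\Phi_\ell\rangle_N=\sum_{j=1}^N w_j\epsilon_j\Phi_\ell(\mathbf{x}_j)$). Further, $\mathbf{W}=\mathrm{diag}(w_1,\dots,w_N)$, $\mathbf{A}\in\mathbb{R}^{N\times d_n}$ with $[\mathbf{A}]_{j\ell}=\Phi_\ell(\mathbf{x}_j)$, $\mathbf{f}=[f(\mathbf{x}_1),\dots,f(\mathbf{x}_N)]^{\mathrm{T}}$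 (noise-free samples), and $\|\cdot\|_2$ on vectors is the Euclidean norm. Soft thresholding operator: $\eta_S(a,k)=\max(0,a-k)+\min(0,a+k)$. Hard thresholding operator: $\eta_H(a,k)=a$ if $|a|>k$ and $\eta_H(a,k)=0$ if $|a|\le k$. Lasso hyperinterpolation with positive penalty parameters $\mu_\ell$ is $\mathcal{L}_n^\lambda f=\sum_{\ell=1}^{d_n}\eta_S(\langle f,\Phi_\ell\rangle_N,\lambda\mu_\ell)\Phi_\ell$; hard thresholding hyperinterpolation is $\mathcal{H}_n^\lambda f=\sum_{\ell=1}^{d_n}\eta_H(\langle f,\Phi_\ell\rangle_N,\lambda)\Phi_\ell$. Thus $\bm{\gamma}^\lambda$ and $\bm{\beta}^\lambda$ are the coefficient vectors of $\mathcal{L}_n^\lambda f^\epsilon$ (with $\mu_\ell=1$) and $\mathcal{H}_n^\lambda f^\epsilon$. $\mathrm{sgn}$ is the sign function. *)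

theory Defs
  imports "HOL-Analysis.Analysis" "HOL-Library.Function_Algebras"
begin

subsection \<open>Compact smooth submanifolds of a Euclidean space\<close>

(* Intended for open S: k-fold continuous differentiability, by recursion on the
   directional derivatives. *)
primrec Ck_on :: "nat \<Rightarrow> ('a::euclidean_space \<Rightarrow> 'b::real_normed_vector) \<Rightarrow> 'a set \<Rightarrow> bool" where
  "Ck_on 0 f S \<longleftrightarrow> continuous_on S f"
| "Ck_on (Suc k) f S \<longleftrightarrow> (\<forall>x\<in>S. f differentiable (at x)) \<and>
     (\<forall>v. Ck_on k (\<lambda>x. frechet_derivative f (at x) v) S)"

definition smooth_on :: "'a set \<Rightarrow> ('a::euclidean_space \<Rightarrow> 'b::real_normed_vector) \<Rightarrow> bool" where
  "smooth_on S f \<longleftrightarrow> (\<forall>k. Ck_on k f S)"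

definition diffeomorphism_on ::
  "'a set \<Rightarrow> 'a set \<Rightarrow> ('a::euclidean_space \<Rightarrow> 'a) \<Rightarrow> ('a \<Rightarrow> 'a) \<Rightarrow> bool" where
  "diffeomorphism_on U V \<phi> \<psi> \<longleftrightarrow>
     open U \<and> open V \<and> homeomorphism U V \<phi> \<psi> \<and> smooth_on U \<phi> \<and> smooth_on V \<psi>"

(* Embedded m-dimensional smooth submanifold with smooth or empty boundary: around each
   of its points some diffeomorphism of the ambient space straightens M to an open piece
   of an m-dimensional subspace T (interior points) or of a closed half space of T
   (boundary points). The Riemannian metric is the one induced by the ambient inner
   product, so it is not a separate datum. *)
definition smooth_submanifold :: "nat \<Rightarrow> ('a::euclidean_space) set \<Rightarrow> bool" where
  "smooth_submanifold m M \<longleftrightarrow>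
     (\<forall>p\<in>M. \<exists>U V \<phi> \<psi> T. p \<in> U \<and> diffeomorphism_on U V \<phi> \<psi> \<and> subspace T \<and> dim T = m \<and>
        (\<phi> ` (M \<inter> U) = V \<inter> T \<or>
         (\<exists>u\<in>T. u \<noteq> 0 \<and> \<phi> ` (M \<inter> U) = V \<inter> {y\<in>T. 0 \<le> u \<bullet> y})))"

definition compact_smooth_manifold :: "('a::euclidean_space) set \<Rightarrow> bool" where
  "compact_smooth_manifold M \<longleftrightarrow> compact M \<and> (\<exists>m. smooth_submanifold m M)"

(* A finite measure living on Omega, for which at least the Borel subsets of Omega
   are measurable (so completed measures are admitted as well). *)
definition finite_measure_on :: "('a::topological_space) measure \<Rightarrow> 'a set \<Rightarrow> bool" where
  "finite_measure_on M \<Omega> \<longleftrightarrow>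
     space M = \<Omega> \<and> sets (restrict_space borel \<Omega>) \<subseteq> sets M \<and> finite_measure M"


subsection \<open>Polynomial spaces\<close>

interpretation fun_vs: vector_space "\<lambda>(c::real) (f::'a \<Rightarrow> real) x. c * f x"
  by unfold_locales (auto simp: fun_eq_iff algebra_simps)

(* Real functions on Omega are represented by their extension by zero, so that equality
   of the representatives is equality on Omega; hence span, independence and dimension
   below are those of the space of functions on Omega. *)
definition zero_extension :: "'a set \<Rightarrow> ('a \<Rightarrow> real) \<Rightarrow> 'a \<Rightarrow> real" where
  "zero_extension \<Omega> p = (\<lambda>y. if y \<in> \<Omega> then p y else 0)"

definition polynomials_upto :: "nat \<Rightarrow> (real^'s \<Rightarrow> real) set" where
  "polynomials_upto n =
     {p. \<exists>c :: ('s \<Rightarrow> nat) \<Rightarrow> real.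
           \<forall>y. p y = (\<Sum>a\<in>{a. (\<Sum>i\<in>UNIV. a i) \<le> n}. c a * (\<Prod>i\<in>UNIV. (y $ i) ^ a i))}"

lemma finite_multi_indices: "finite {a :: 's::finite \<Rightarrow> nat. (\<Sum>i\<in>UNIV. a i) \<le> n}"
proof (rule finite_subset)
  show "{a :: 's \<Rightarrow> nat. (\<Sum>i\<in>UNIV. a i) \<le> n} \<subseteq> Pi\<^sub>E UNIV (\<lambda>_. {..n})"
    by (auto simp: PiE_def Pi_def intro: order_trans[OF member_le_sum[of _ UNIV]])
  show "finite (Pi\<^sub>E (UNIV :: 's set) (\<lambda>_. {..n}))"
    by (intro finite_PiE) auto
qed

definition poly_space :: "nat \<Rightarrow> (real^'s) set \<Rightarrow> (real^'s \<Rightarrow> real) set" where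
  "poly_space n \<Omega> = zero_extension \<Omega> ` polynomials_upto n"

definition inner_prod :: "'a measure \<Rightarrow> ('a \<Rightarrow> real) \<Rightarrow> ('a \<Rightarrow> real) \<Rightarrow> real" where
  "inner_prod M f g = (LINT y|M. f y * g y)"

definition orthonormal_basis ::
  "'a measure \<Rightarrow> ('a \<Rightarrow> real) set \<Rightarrow> ('d \<Rightarrow> 'a \<Rightarrow> real) \<Rightarrow> bool" where
  "orthonormal_basis M P \<Phi> \<longleftrightarrow>
     inj \<Phi> \<and> fun_vs.independent (range \<Phi>) \<and> fun_vs.span (range \<Phi>) = P \<and>
     (\<forall>k l. inner_prod M (\<Phi> k) (\<Phi> l) = (if k = l then 1 else 0))"


subsection \<open>Quadrature\<close>

definition quadrature_exact ::
  "(real^'s) measure \<Rightarrow> (real^'s) set \<Rightarrow> nat \<Rightarrow> real^'N \<Rightarrow> ('N \<Rightarrow> real^'s) \<Rightarrow> bool" where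
  "quadrature_exact M \<Omega> k w x \<longleftrightarrow>
     (\<forall>p\<in>poly_space k \<Omega>. (LINT y|M. p y) = (\<Sum>j\<in>UNIV. w $ j * p (x j)))"

definition samples :: "('N \<Rightarrow> 'a) \<Rightarrow> ('a \<Rightarrow> real) \<Rightarrow> real^'N" where
  "samples x f = (\<chi> j. f (x j))"

(* The discrete inner product takes vectors of values at the nodes, since the noise is
   only given there. *)
definition discrete_inner :: "real^'N \<Rightarrow> real^'N \<Rightarrow> real^'N \<Rightarrow> real" where
  "discrete_inner w u v = (\<Sum>j\<in>UNIV. w $ j * u $ j * v $ j)"

definition diag_mat :: "real^'N \<Rightarrow> real^'N^'N" where
  "diag_mat v = (\<chi> i j. if i = j then v $ i else 0)"

(* The square root of diag_mat w, for nonnegative w. *)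
definition sqrt_diag_mat :: "real^'N \<Rightarrow> real^'N^'N" where
  "sqrt_diag_mat w = diag_mat (\<chi> j. sqrt (w $ j))"

lemma sqrt_diag_mat_square:
  assumes "\<forall>j. 0 \<le> w $ j"
  shows "sqrt_diag_mat w ** sqrt_diag_mat w = diag_mat w"
  using assms
  by (simp add: sqrt_diag_mat_def diag_mat_def matrix_matrix_mult_def vec_eq_iff
      if_distrib[of "\<lambda>t. _ * t"] cong: if_cong)

definition sampling_matrix :: "('N \<Rightarrow> 'a) \<Rightarrow> ('d \<Rightarrow> 'a \<Rightarrow> real) \<Rightarrow> real^'d^'N" where
  "sampling_matrix x \<Phi> = (\<chi> j l. \<Phi> l (x j))"


subsection \<open>Thresholding and hyperinterpolation\<close>

definition eta_S :: "real \<Rightarrow> real \<Rightarrow> real" where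
  "eta_S a k = max 0 (a - k) + min 0 (a + k)"

definition eta_H :: "real \<Rightarrow> real \<Rightarrow> real" where
  "eta_H a k = (if \<bar>a\<bar> > k then a else 0)"

definition lasso_hyperinterpolation ::
  "real^'N \<Rightarrow> ('N \<Rightarrow> 'a) \<Rightarrow> ('d::finite \<Rightarrow> 'a \<Rightarrow> real) \<Rightarrow> real \<Rightarrow> ('d \<Rightarrow> real) \<Rightarrow> ('a \<Rightarrow> real) \<Rightarrow> 'a \<Rightarrow> real"
  where "lasso_hyperinterpolation w x \<Phi> lam \<mu> f =
    (\<lambda>y. \<Sum>l\<in>UNIV. eta_S (discrete_inner w (samples x f) (samples x (\<Phi> l))) (lam * \<mu> l) * \<Phi> l y)"

definition hard_hyperinterpolation ::
  "real^'N \<Rightarrow> ('N \<Rightarrow> 'a) \<Rightarrow> ('d::finite \<Rightarrow> 'a \<Rightarrow> real) \<Rightarrow> real \<Rightarrow> ('a \<Rightarrow> real) \<Rightarrow> 'a \<Rightarrow> real"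
  where "hard_hyperinterpolation w x \<Phi> lam f =
    (\<lambda>y. \<Sum>l\<in>UNIV. eta_H (discrete_inner w (samples x f) (samples x (\<Phi> l))) lam * \<Phi> l y)"

(* The coefficient vectors appearing in the error functionals below are those of the
   two operators. *)
lemma lasso_hyperinterpolation_coeffs:
  fixes \<alpha> \<gamma> :: "real^'d"
  assumes "\<forall>l. \<alpha> $ l = discrete_inner w (samples x f) (samples x (\<Phi> l))"
    and "\<forall>l. \<gamma> $ l = eta_S (\<alpha> $ l) lam"
  shows "lasso_hyperinterpolation w x \<Phi> lam (\<lambda>_. 1) f = (\<lambda>y. \<Sum>l\<in>UNIV. \<gamma> $ l * \<Phi> l y)"
  using assms by (simp add: lasso_hyperinterpolation_def)

lemma hard_hyperinterpolation_coeffs: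
  fixes \<alpha> \<beta> :: "real^'d"
  assumes "\<forall>l. \<alpha> $ l = discrete_inner w (samples x f) (samples x (\<Phi> l))"
    and "\<forall>l. \<beta> $ l = eta_H (\<alpha> $ l) lam"
  shows "hard_hyperinterpolation w x \<Phi> lam f = (\<lambda>y. \<Sum>l\<in>UNIV. \<beta> $ l * \<Phi> l y)"
  using assms by (simp add: hard_hyperinterpolation_def)

definition J :: "real^'d \<Rightarrow> real^'d \<Rightarrow> real" where
  "J \<alpha> z = z \<bullet> z - 2 * (z \<bullet> \<alpha>)"

definition H :: "real^'d \<Rightarrow> real^'d \<Rightarrow> real" where
  "H \<xi> z = 2 * (z \<bullet> \<xi>)"

definition E :: "real^'N \<Rightarrow> real^'d^'N \<Rightarrow> real^'N \<Rightarrow> real^'d \<Rightarrow> real" where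
  "E w A v z = (norm (sqrt_diag_mat w *v (A *v z - v)))\<^sup>2"

end

theory Submission
  imports Defs
begin

text \<open>
  The product of two basis functions has degree at most \<open>2 n\<close>, so exactness makes the basis
  orthonormal for the discrete inner product as well. Expanding the weighted square in \<open>E\<close>
  therefore yields \<open>J + H\<close> plus a constant, and \<open>J + H\<close> splits over the coordinates. Where
  \<open>\<bar>\<alpha> $ l\<bar> > lam\<close> the summands for soft and hard thresholding differ by
  \<open>lam * (lam - 2 * sgn (\<alpha> $ l) * \<xi> $ l)\<close>; elsewhere both vanish.
\<close>

text \<open>Multiplying out and collecting equal monomials convolves the two coefficient families
  over multi-indices.\<close>

lemma polynomials_upto_mult:
  assumes "p \<in> polynomials_upto m" "q \<in> polynomials_upto n"
  shows "(\<lambda>y. p y * q y) \<in> polynomials_upto (m + n)"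
proof -
  let ?S = "\<lambda>k. {a :: 'a \<Rightarrow> nat. (\<Sum>i\<in>UNIV. a i) \<le> k}"
  let ?mon = "\<lambda>a (y :: real^'a). \<Prod>i\<in>UNIV. (y $ i) ^ a i"
  let ?add = "\<lambda>(a, b) (i :: 'a). (a i + b i :: nat)"
  obtain c where c: "\<And>y. p y = (\<Sum>a\<in>?S m. c a * ?mon a y)"
    using assms(1) unfolding polynomials_upto_def by auto
  obtain d where d: "\<And>y. q y = (\<Sum>a\<in>?S n. d a * ?mon a y)"
    using assms(2) unfolding polynomials_upto_def by auto
  \<comment> \<open>The coefficient at \<open>s\<close> collects every pair of exponents within the
    two degree bounds that adds up to \<open>s\<close>.\<close>
  define e where "e s = (\<Sum>(a, b)\<in>{u \<in> ?S m \<times> ?S n. ?add u = s}. c a * d b)" for s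
  have "p y * q y = (\<Sum>s\<in>?S (m + n). e s * ?mon s y)" for y
  proof -
    have "p y * q y = (\<Sum>(a, b)\<in>?S m \<times> ?S n. c a * ?mon a y * (d b * ?mon b y))"
      by (simp add: c d sum_product sum.cartesian_product)
    also have "\<dots> = (\<Sum>u\<in>?S m \<times> ?S n. c (fst u) * d (snd u) * ?mon (?add u) y)"
      by (rule sum.cong) (auto simp: power_add prod.distrib algebra_simps)
    also have "\<dots> = (\<Sum>s\<in>?S (m + n). \<Sum>u\<in>{u \<in> ?S m \<times> ?S n. ?add u = s}.
        c (fst u) * d (snd u) * ?mon (?add u) y)"
      \<comment> \<open>Grouping by fibres is legitimate because degrees add: \<open>?add\<close>
        maps \<open>?S m \<times> ?S n\<close> into \<open>?S (m + n)\<close>.\<close>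
      by (rule sum.group[symmetric])
        (auto simp: finite_multi_indices sum.distrib intro!: add_mono)
    also have "\<dots> = (\<Sum>s\<in>?S (m + n). e s * ?mon s y)"
      unfolding e_def sum_distrib_right
      by (intro sum.cong refl) auto
    finally show ?thesis .
  qed
  then show ?thesis unfolding polynomials_upto_def by blast
qed

lemma poly_space_mult:
  assumes "p \<in> poly_space m \<Omega>" "q \<in> poly_space n \<Omega>"
  shows "(\<lambda>y. p y * q y) \<in> poly_space (m + n) \<Omega>"
proof -
  obtain p' q' where "p' \<in> polynomials_upto m" "p = zero_extension \<Omega> p'"
    and "q' \<in> polynomials_upto n" "q = zero_extension \<Omega> q'"
    using assms unfolding poly_space_def by auto
  moreover from this have "(\<lambda>y. p y * q y) = zero_extension \<Omega> (\<lambda>y. p' y * q' y)"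
    by (auto simp: zero_extension_def)
  ultimately show ?thesis
    unfolding poly_space_def using polynomials_upto_mult by blast
qed

lemma discrete_inner_orthonormal:
  fixes \<Phi> :: "'d::finite \<Rightarrow> real^'s \<Rightarrow> real" and x :: "'N::finite \<Rightarrow> real^'s"
  assumes basis: "orthonormal_basis M (poly_space n \<Omega>) \<Phi>"
    and exact: "quadrature_exact M \<Omega> (2 * n) w x"
  shows "discrete_inner w (samples x (\<Phi> k)) (samples x (\<Phi> l)) = (if k = l then 1 else 0)"
proof -
  have "\<Phi> i \<in> poly_space n \<Omega>" for i
    using basis fun_vs.span_base[of "\<Phi> i" "range \<Phi>"] unfolding orthonormal_basis_def by auto
  then have "(\<lambda>y. \<Phi> k y * \<Phi> l y) \<in> poly_space (2 * n) \<Omega>"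
    unfolding mult_2 by (intro poly_space_mult)
  then have "inner_prod M (\<Phi> k) (\<Phi> l) = (\<Sum>j\<in>UNIV. w $ j * (\<Phi> k (x j) * \<Phi> l (x j)))"
    using exact unfolding quadrature_exact_def inner_prod_def by blast
  with basis show ?thesis
    by (simp add: orthonormal_basis_def discrete_inner_def samples_def mult.assoc)
qed

text \<open>The matrix is diagonal, so it scales each entry separately; nonnegative weights make the
  square of \<open>sqrt (w $ j)\<close> equal to \<open>w $ j\<close>.\<close>

lemma norm_sqrt_diag_mat_square:
  assumes "\<forall>j. 0 \<le> w $ j"
  shows "(norm (sqrt_diag_mat w *v v))\<^sup>2 = discrete_inner w v v"
proof -
  have "(sqrt_diag_mat w *v v) $ j = sqrt (w $ j) * v $ j" for j
    by (simp add: sqrt_diag_mat_def diag_mat_def matrix_vector_mult_def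
        if_distrib[of "\<lambda>t. t * _"] cong: if_cong)
  moreover have "(sqrt (w $ j) * v $ j)\<^sup>2 = w $ j * v $ j * v $ j" for j
    using assms by (simp add: power_mult_distrib power2_eq_square)
  ultimately show ?thesis
    by (simp add: power2_norm_eq_inner inner_vec_def discrete_inner_def flip: power2_eq_square)
qed

lemma discrete_inner_diff_square:
  "discrete_inner w (u - v) (u - v) =
    discrete_inner w u u - 2 * discrete_inner w v u + discrete_inner w v v"
  by (simp add: discrete_inner_def sum_distrib_left algebra_simps
      flip: sum_subtractf sum.distrib)

text \<open>Column \<open>l\<close> of the sampling matrix is \<open>samples x (\<Phi> l)\<close>,
  so this is linearity in the second argument.\<close>

lemma discrete_inner_sampling_matrix:
  "discrete_inner w v (sampling_matrix x \<Phi> *v z) =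
    (\<Sum>l\<in>UNIV. z $ l * discrete_inner w v (samples x (\<Phi> l)))"
  unfolding discrete_inner_def sampling_matrix_def samples_def matrix_vector_mult_def
  by (simp add: sum_distrib_left mult_ac) (rule sum.swap)

lemma discrete_inner_commute: "discrete_inner w u v = discrete_inner w v u"
  by (simp add: discrete_inner_def mult_ac)

lemma E_eq_J_plus_H:
  fixes \<Phi> :: "'d::finite \<Rightarrow> 'a \<Rightarrow> real" and x :: "'N::finite \<Rightarrow> 'a" and \<alpha> \<xi> :: "real^'d"
  assumes weights: "\<forall>j. 0 \<le> w $ j"
    and orth: "\<And>k l. discrete_inner w (samples x (\<Phi> k)) (samples x (\<Phi> l)) =
      (if k = l then 1 else 0)"
    and alpha: "\<And>l. \<alpha> $ l = discrete_inner w (v + \<epsilon>) (samples x (\<Phi> l))"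
    and xi: "\<And>l. \<xi> $ l = discrete_inner w \<epsilon> (samples x (\<Phi> l))"
  shows "E w (sampling_matrix x \<Phi>) v z = J \<alpha> z + H \<xi> z + (norm (sqrt_diag_mat w *v v))\<^sup>2"
proof -
  let ?Az = "sampling_matrix x \<Phi> *v z"
  have "discrete_inner w ?Az (samples x (\<Phi> l)) = z $ l" for l
    by (subst discrete_inner_commute)
      (simp add: discrete_inner_sampling_matrix orth if_distrib[of "\<lambda>t. _ * t"] cong: if_cong)
  then have Az: "discrete_inner w ?Az ?Az = z \<bullet> z"
    by (simp add: discrete_inner_sampling_matrix inner_vec_def)
  \<comment> \<open>Removing the noise from the data subtracts its coefficients; the cross term of
    the square thus splits between \<open>J\<close> and \<open>H\<close>.\<close>
  have "discrete_inner w v (samples x (\<Phi> l)) = \<alpha> $ l - \<xi> $ l" for l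
    unfolding alpha xi by (simp add: discrete_inner_def algebra_simps sum.distrib)
  then have "discrete_inner w v ?Az = z \<bullet> (\<alpha> - \<xi>)"
    by (simp add: discrete_inner_sampling_matrix inner_vec_def)
  with Az show ?thesis
    by (simp add: E_def J_def H_def norm_sqrt_diag_mat_square[OF weights]
        discrete_inner_diff_square inner_diff_right)
qed

lemma J_nonpos:
  assumes "\<And>l. z $ l * z $ l \<le> 2 * (z $ l * \<alpha> $ l)"
  shows "J \<alpha> z \<le> 0"
  unfolding J_def inner_vec_def using assms by (simp add: sum_distrib_left sum_mono)

text \<open>For \<open>k \<ge> 0\<close> at most one of the two clipped terms is nonzero. This form
  shares its case split with \<open>eta_H\<close>.\<close>

lemma eta_S_cases:
  assumes "k \<ge> 0"
  shows "eta_S a k = (if \<bar>a\<bar> > k then a - sgn a * k else 0)"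
  using assms by (auto simp: eta_S_def sgn_if)

lemma eta_S_square_le:
  assumes "k \<ge> 0"
  shows "eta_S a k * eta_S a k \<le> 2 * (eta_S a k * a)"
proof -
  \<comment> \<open>Shrinking towards zero keeps the sign of \<open>a\<close> and does not increase
    its modulus, so the two factors never have opposite signs.\<close>
  have "0 \<le> eta_S a k * (2 * a - eta_S a k)"
    using assms by (cases "a \<ge> 0") (auto simp: eta_S_cases sgn_if zero_le_mult_iff)
  then show ?thesis by (simp add: algebra_simps)
qed

lemma J_plus_H_thresholding_diff:
  assumes lam: "lam \<ge> 0"
    and gamma: "\<And>l. \<gamma> $ l = eta_S (\<alpha> $ l) lam"
    and beta: "\<And>l. \<beta> $ l = eta_H (\<alpha> $ l) lam"
  shows "J \<alpha> \<gamma> + H \<xi> \<gamma> - (J \<alpha> \<beta> + H \<xi> \<beta>) =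
    lam * (\<Sum>l | \<bar>\<alpha> $ l\<bar> > lam. lam - 2 * sgn (\<alpha> $ l) * \<xi> $ l)"
proof -
  define t where "t z l = z $ l * z $ l - 2 * (z $ l * \<alpha> $ l) + 2 * (z $ l * \<xi> $ l)" for z l
  have split: "J \<alpha> z + H \<xi> z = sum (t z) UNIV" for z
    by (simp add: J_def H_def t_def inner_vec_def sum.distrib sum_subtractf sum_distrib_left)
  \<comment> \<open>By completing the square, \<open>t z l\<close> is \<open>(z $ l - \<alpha> $
    l)\<^sup>2 - (\<alpha> $ l)\<^sup>2 + 2 * z $ l * \<xi> $ l\<close>. Above the threshold the
    first square is \<open>lam\<^sup>2\<close> for \<open>\<gamma>\<close> and zero for
    \<open>\<beta>\<close>.\<close>
  have "t \<gamma> l - t \<beta> l =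
      (if \<bar>\<alpha> $ l\<bar> > lam then lam * (lam - 2 * sgn (\<alpha> $ l) * \<xi> $ l) else 0)" for l
    using lam by (auto simp: t_def gamma beta eta_S_cases eta_H_def sgn_if algebra_simps)
  then show ?thesis
    unfolding split by (simp add: sum_distrib_left sum.If_cases flip: sum_subtractf)
qed

theorem theorem4p4:
  fixes \<Omega> :: "(real^'s) set" and M :: "(real^'s) measure" and n :: nat
    and \<Phi> :: "'d::finite \<Rightarrow> real^'s \<Rightarrow> real"
    and x :: "'N::finite \<Rightarrow> real^'s" and w :: "real^'N"
    and f f\<epsilon> :: "real^'s \<Rightarrow> real" and \<epsilon> fv :: "real^'N" and A :: "real^'d^'N"
    and lam :: real and \<alpha> \<xi> \<gamma> \<beta> :: "real^'d"
  assumes manifold: "compact_smooth_manifold \<Omega>"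
    and measure: "finite_measure_on M \<Omega>"
    and dimension: "CARD('d) = fun_vs.dim (poly_space n \<Omega>)"
    and basis: "orthonormal_basis M (poly_space n \<Omega>) \<Phi>"
    and nodes: "\<forall>j. x j \<in> \<Omega>"
    and weights: "\<forall>j. w $ j > 0"
    and exact: "quadrature_exact M \<Omega> (2 * n) w x"
    and continuous: "continuous_on \<Omega> f"
    and noise: "\<forall>j. f\<epsilon> (x j) = f (x j) + \<epsilon> $ j"
    and lam: "lam > 0"
    and fv: "fv = samples x f"
    and A: "A = sampling_matrix x \<Phi>"
    and alpha: "\<forall>l. \<alpha> $ l = discrete_inner w (samples x f\<epsilon>) (samples x (\<Phi> l))"
    and xi: "\<forall>l. \<xi> $ l = discrete_inner w \<epsilon> (samples x (\<Phi> l))"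
    and gamma: "\<forall>l. \<gamma> $ l = eta_S (\<alpha> $ l) lam"
    and beta: "\<forall>l. \<beta> $ l = eta_H (\<alpha> $ l) lam"
  shows "(E w A fv \<gamma> = J \<alpha> \<gamma> + H \<xi> \<gamma> + (norm (sqrt_diag_mat w *v fv))\<^sup>2 \<and> J \<alpha> \<gamma> \<le> 0) \<and>
    (E w A fv \<beta> = J \<alpha> \<beta> + H \<xi> \<beta> + (norm (sqrt_diag_mat w *v fv))\<^sup>2 \<and> J \<alpha> \<beta> \<le> 0) \<and>
    ((\<Sum>l | \<bar>\<alpha> $ l\<bar> > lam. lam - 2 * sgn (\<alpha> $ l) * \<xi> $ l) \<ge> 0 \<longrightarrow>
      E w A fv \<beta> \<le> E w A fv \<gamma>)"
proof -
  have "samples x f\<epsilon> = fv + \<epsilon>"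
    using noise by (simp add: fv samples_def vec_eq_iff)
  \<comment> \<open>The identity holds for every \<open>z\<close>, so \<open>\<gamma>\<close> and
    \<open>\<beta>\<close> are both instances and share the constant, which cancels in the final
    comparison.\<close>
  then have E_eq: "E w A fv z = J \<alpha> z + H \<xi> z + (norm (sqrt_diag_mat w *v fv))\<^sup>2" for z
    unfolding A
    using weights alpha xi
    by (intro E_eq_J_plus_H discrete_inner_orthonormal[OF basis exact]) (auto intro: less_imp_le)
  have "J \<alpha> \<gamma> \<le> 0"
    using lam gamma by (intro J_nonpos) (simp add: eta_S_square_le)
  moreover have "J \<alpha> \<beta> \<le> 0"
    \<comment> \<open>Each entry of \<open>\<beta>\<close> is \<open>\<alpha> $ l\<close> or zero,
      so the condition is that a square is at most twice itself.\<close>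
    using beta by (intro J_nonpos) (simp add: eta_H_def)
  moreover have "E w A fv \<beta> \<le> E w A fv \<gamma>"
    if "(\<Sum>l | \<bar>\<alpha> $ l\<bar> > lam. lam - 2 * sgn (\<alpha> $ l) * \<xi> $ l) \<ge> 0"
  proof -
    have "0 \<le> J \<alpha> \<gamma> + H \<xi> \<gamma> - (J \<alpha> \<beta> + H \<xi> \<beta>)"
      using J_plus_H_thresholding_diff[of lam \<gamma> \<alpha> \<beta> \<xi>] lam gamma beta that by simp
    then show ?thesis by (simp add: E_eq)
  qed
  ultimately show ?thesis using E_eq by blast
qed

end
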